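(* There are absolute constants $c_1>0$ and $0<\alpha\leqslant\beta$ such that the following holds. Let $p$ be a prime, let $A\subseteq\mathbb{F}_p$, and let $R=R(A):=c_1\max\left((\log p)^{1/2},\frac{\log p}{\log|A|}\right)$. Then $A$ can be partitioned as $$A=D_1\cup\cdots\cup D_s\cup E$$ (for some integer $s\geqslant 0$) such that: (i) each $D_j$ is a dissociated set with $\alpha R\leqslant |D_j|\leqslant \beta R$; (ii) $|E|\geqslant R/2$ if $s>0$; (iii) there is some $\lambda\in\mathbb{F}_p^\times$ such that $\lambda\cdot(E\cup\{\delta\})\subseteq\left(-\frac{p}{90(|E|+1)},\frac{p}{90(|E|+1)}\right)$, where $\delta:=\sum_{j=1}^s\sum_{d\in D_j}d$ is the sum of all elements of the sets $D_j$.
   Context: A finite subset $D=\{d_1,\ldots,d_r\}$ of an abelian group is dissociated if $\varepsilon_1d_1+\cdots+\varepsilon_rd_r\neq 0$ for all $(\varepsilon_1,\ldots,\varepsilon_r)\in\{-1,0,1\}^r\setminus\{0\}$. For $\lambda\in\mathbb{F}_p$ and $X\subseteq\mathbb{F}_p$, $\lambda\cdot X:=\{\lambda x:x\in X\}$. Elements of $\mathbb{F}_p$ are identified with integers in $(-p/2,p/2)$ in the natural way, so that containment of subsets of $\mathbb{F}_p$ in real intervals around $0$ makes sense. When $|A|\leqslant 1$, $\log p/\log|A|$ is interpreted as $+\infty$.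
   Formalization: The claim is proved for all primes p ≥ p0 with an absolute constant p0, not for every prime p; as stated it fails for small p, e.g. p = 5, A = {1,2}, where (iii) forces E to be empty and then (ii) fails. *)

theory Defs
  imports
    "HOL-Number_Theory.Residues"
    "HOL-Library.Disjoint_Sets"
    "HOL-Library.Extended_Real"
begin

definition dissociated :: "('a, 'm) ring_scheme \<Rightarrow> 'a set \<Rightarrow> bool" where
  "dissociated G D \<longleftrightarrow>
     finite D \<and> D \<subseteq> carrier G \<and>
     (\<forall>\<epsilon> :: 'a \<Rightarrow> int. (\<forall>d\<in>D. \<epsilon> d \<in> {-1, 0, 1}) \<and> (\<exists>d\<in>D. \<epsilon> d \<noteq> 0) \<longrightarrow>
        (\<Oplus>\<^bsub>G\<^esub>d\<in>D. [\<epsilon> d] \<cdot>\<^bsub>G\<^esub> d) \<noteq> \<zero>\<^bsub>G\<^esub>)"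

abbreviation Fp :: "nat \<Rightarrow> int ring" where
  "Fp p \<equiv> residue_ring (int p)"

definition dilate :: "nat \<Rightarrow> int \<Rightarrow> int set \<Rightarrow> int set" where
  "dilate p l X = (\<lambda>x. l \<otimes>\<^bsub>Fp p\<^esub> x) ` X"

text \<open>
  The carrier of \<^term>\<open>Fp p\<close> is \<open>{0..p - 1}\<close>; each element is identified here with its
  representative of least absolute value. For odd \<open>p\<close> this is the one in \<open>(-p/2, p/2)\<close>.
  For \<open>p = 2\<close> the class of \<open>1\<close> has no representative in that open interval and is sent to \<open>1\<close>.
\<close>
definition balanced_rep :: "nat \<Rightarrow> int \<Rightarrow> int" where
  "balanced_rep p x = (if 2 * x \<le> int p then x else x - int p)"

text \<open>
  The value is extended real because \<open>log p / log |A|\<close> is read as \<open>+\<infinity>\<close> when \<open>|A| \<le> 1\<close>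
  (in HOL the real quotient would be \<open>0\<close>).
\<close>
definition R_param :: "real \<Rightarrow> nat \<Rightarrow> int set \<Rightarrow> ereal" where
  "R_param c p A =
     ereal c * max (ereal (sqrt (ln (real p))))
                   (if card A \<le> 1 then \<infinity> else ereal (ln (real p) / ln (real (card A))))"

end

theory Submission
  imports Defs
begin

text \<open>
  Greedily remove dissociated sets of size about \<open>R\<close> until the rest \<open>E\<close> contains none. If \<open>E\<close> is
  then too small, about half of one of the removed sets is returned to it. Either way \<open>E\<close> consists
  of \<open>{-1, 0, 1}\<close>-combinations of a set \<open>B\<close> with \<open>n = |B| + 1 \<le> 3 R\<close>: a maximal dissociated subset
  of \<open>E\<close>, or \<open>E\<close> itself. By Dirichlet's pigeonhole argument some \<open>\<lambda> \<noteq> 0\<close> dilates all of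
  \<open>B \<union> {\<delta>}\<close> into \<open>(-p/Q, p/Q)\<close> as soon as \<open>Q\<^sup>n < p\<close>, and \<open>Q = 90 (|E| + 1)\<^sup>2\<close> leaves enough room
  to sum up to \<open>|E|\<close> such elements. If \<open>log p / log |A|\<close> is the larger term of \<open>R\<close>, then
  \<open>Q\<^sup>n < p\<close> follows from \<open>|E| \<le> |A|\<close>; otherwise it follows from \<open>|E| \<le> 3\<^sup>|\<^sup>B\<^sup>|\<close>.
\<close>

section \<open>Arithmetic and dissociation in \<open>Fp p\<close> expressed by integer
  congruences\<close>

lemma finsum_Fp:
  assumes "p > 1" and "finite D" and "\<And>d. d \<in> D \<Longrightarrow> f d \<in> carrier (Fp p)"
  shows "finsum (Fp p) f D = (\<Sum>d\<in>D. f d) mod int p"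
proof -
  interpret residues "int p" "Fp p"
    using assms(1) by unfold_locales auto
  show ?thesis
    using assms(2,3)
  proof (induction D rule: finite_induct)
    case empty
    then show ?case
      by (simp add: finsum_empty res_zero_eq)
  next
    case (insert x D)
    have "finsum (Fp p) f (insert x D) = f x \<oplus>\<^bsub>Fp p\<^esub> finsum (Fp p) f D"
      using insert by (intro finsum_insert) auto
    then show ?case
      using insert by (simp add: res_add_eq mod_add_right_eq)
  qed
qed

lemma add_pow_Fp:
  fixes k :: int
  assumes "p > 1" and "x \<in> carrier (Fp p)"
  shows "[k] \<cdot>\<^bsub>Fp p\<^esub> x = (k * x) mod int p"
proof -
  interpret residues "int p" "Fp p"
    using assms(1) by unfold_locales auto
  have nat: "[n] \<cdot>\<^bsub>Fp p\<^esub> x = (int n * x) mod int p" for n :: nat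
  proof (induction n)
    case 0
    then show ?case by (simp add: res_zero_eq)
  next
    case (Suc n)
    then show ?case
      by (simp add: add.nat_pow_Suc res_add_eq mod_simps algebra_simps)
  qed
  show ?thesis
  proof (cases "k \<ge> 0")
    case True
    then show ?thesis
      using nat[of "nat k"] by (simp add: add_pow_int_ge)
  next
    case False
    then show ?thesis
      using nat[of "nat (- k)"] by (simp add: add_pow_int_lt res_neg_eq mod_minus_eq)
  qed
qed

text \<open>Turns a relation between ring elements into divisibility of an integer sum, so that the
  later arguments compute with integers and never with the operations of
  \<open>Fp p\<close>.\<close>

lemma dissociated_Fp_iff:
  assumes "p > 1"
  shows "dissociated (Fp p) D \<longleftrightarrow>
    finite D \<and> D \<subseteq> carrier (Fp p) \<and>
    (\<forall>\<epsilon>. (\<forall>d\<in>D. \<epsilon> d \<in> {-1, 0, 1}) \<and> (\<exists>d\<in>D. \<epsilon> d \<noteq> 0) \<longrightarrow>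
       \<not> int p dvd (\<Sum>d\<in>D. \<epsilon> d * d))"
proof -
  interpret residues "int p" "Fp p"
    using assms by unfold_locales auto
  have "(\<Oplus>\<^bsub>Fp p\<^esub>d\<in>D. [\<epsilon> d] \<cdot>\<^bsub>Fp p\<^esub> d) = \<zero>\<^bsub>Fp p\<^esub> \<longleftrightarrow>
      int p dvd (\<Sum>d\<in>D. \<epsilon> d * d)"
    if D: "finite D" "D \<subseteq> carrier (Fp p)" for \<epsilon> :: "int \<Rightarrow> int"
  proof -
    have "(\<Oplus>\<^bsub>Fp p\<^esub>d\<in>D. [\<epsilon> d] \<cdot>\<^bsub>Fp p\<^esub> d) = (\<Sum>d\<in>D. [\<epsilon> d] \<cdot>\<^bsub>Fp p\<^esub> d) mod int p"
      using assms D by (intro finsum_Fp) auto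
    also have "\<dots> = (\<Sum>d\<in>D. (\<epsilon> d * d) mod int p) mod int p"
      using assms D by (intro arg_cong[where f = "\<lambda>x. x mod int p"] sum.cong)
        (auto simp: add_pow_Fp subset_iff)
    also have "\<dots> = (\<Sum>d\<in>D. \<epsilon> d * d) mod int p"
      by (rule mod_sum_eq)
    finally show ?thesis
      by (simp add: res_zero_eq dvd_eq_mod_eq_0)
  qed
  then show ?thesis
    unfolding dissociated_def by blast
qed

text \<open>Coefficients on \<open>D'\<close> extend by zero to \<open>D\<close> without changing
  the sum. This allows dissociated sets to be cut down to a prescribed size.\<close>

lemma dissociated_Fp_mono:
  assumes "p > 1" and "dissociated (Fp p) D" and "D' \<subseteq> D"
  shows "dissociated (Fp p) D'"
  unfolding dissociated_Fp_iff[OF assms(1)]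
proof (intro conjI allI impI)
  have D: "finite D" "D \<subseteq> carrier (Fp p)"
    using assms by (auto simp: dissociated_Fp_iff)
  then show "finite D'" "D' \<subseteq> carrier (Fp p)"
    using assms(3) finite_subset by auto
  fix \<epsilon> :: "int \<Rightarrow> int"
  assume \<epsilon>: "(\<forall>d\<in>D'. \<epsilon> d \<in> {-1, 0, 1}) \<and> (\<exists>d\<in>D'. \<epsilon> d \<noteq> 0)"
  define \<epsilon>' where "\<epsilon>' d = (if d \<in> D' then \<epsilon> d else 0)" for d
  have "(\<forall>d\<in>D. \<epsilon>' d \<in> {-1, 0, 1}) \<and> (\<exists>d\<in>D. \<epsilon>' d \<noteq> 0)"
    using \<epsilon> assms(3) by (auto simp: \<epsilon>'_def)
  then have "\<not> int p dvd (\<Sum>d\<in>D. \<epsilon>' d * d)"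
    using assms(1,2) by (auto simp only: dissociated_Fp_iff)
  also have "(\<Sum>d\<in>D. \<epsilon>' d * d) = (\<Sum>d\<in>D'. \<epsilon> d * d)"
    using D assms(3) by (intro sum.mono_neutral_cong_right) (auto simp: \<epsilon>'_def)
  finally show "\<not> int p dvd (\<Sum>d\<in>D'. \<epsilon> d * d)" .
qed

section \<open>Combinations with coefficients in {-1, 0, 1}\<close>

definition cube_span :: "nat \<Rightarrow> int set \<Rightarrow> int set" where
  "cube_span p B = {e \<in> carrier (Fp p).
     \<exists>\<epsilon>. (\<forall>b\<in>B. \<epsilon> b \<in> {-1, 0, 1}) \<and> [e = (\<Sum>b\<in>B. \<epsilon> b * b)] (mod int p)}"

lemma subset_cube_span:
  assumes "finite B" and "B \<subseteq> carrier (Fp p)"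
  shows "B \<subseteq> cube_span p B"
proof
  fix e assume e: "e \<in> B"
  have "(\<Sum>b\<in>B. (if b = e then 1 else 0) * b) = (\<Sum>b\<in>B. if b = e then b else 0)"
    by (intro sum.cong) auto
  also have "\<dots> = e"
    using assms(1) e by simp
  finally have "[e = (\<Sum>b\<in>B. (if b = e then 1 else 0) * b)] (mod int p)"
    by simp
  moreover have "\<forall>b\<in>B. (if b = e then 1 else 0) \<in> {-1, 0, 1 :: int}"
    by simp
  ultimately show "e \<in> cube_span p B"
    using e assms(2) unfolding cube_span_def
    by (intro CollectI conjI exI[of _ "\<lambda>b. if b = e then 1 else 0"]) auto
qed

text \<open>Each residue in the span is determined by a coefficient vector, and there are
  \<open>3 ^ card B\<close> of these.\<close>

lemma card_cube_span_le:
  assumes "p > 1" and "finite B"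
  shows "card (cube_span p B) \<le> 3 ^ card B"
proof -
  interpret residues "int p" "Fp p"
    using assms(1) by unfold_locales auto
  let ?F = "PiE B (\<lambda>_. {-1, 0, 1 :: int})"
  have "cube_span p B \<subseteq> (\<lambda>\<epsilon>. (\<Sum>b\<in>B. \<epsilon> b * b) mod int p) ` ?F"
  proof
    fix e assume "e \<in> cube_span p B"
    then obtain \<epsilon> where e: "e \<in> {0..int p - 1}" "[e = (\<Sum>b\<in>B. \<epsilon> b * b)] (mod int p)"
      and \<epsilon>: "\<forall>b\<in>B. \<epsilon> b \<in> {-1, 0, 1}"
      unfolding cube_span_def res_carrier_eq by blast
    \<comment> \<open>The values of the coefficients outside \<open>B\<close> are arbitrary;
      \<open>restrict\<close> normalises them, so that the vectors form a finite set.\<close>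
    have "e = (\<Sum>b\<in>B. restrict \<epsilon> B b * b) mod int p"
      using e by (simp add: cong_def)
    moreover have "restrict \<epsilon> B \<in> ?F"
      using \<epsilon> by (intro restrict_PiE_iff[THEN iffD2]) auto
    ultimately show "e \<in> (\<lambda>\<epsilon>. (\<Sum>b\<in>B. \<epsilon> b * b) mod int p) ` ?F"
      by blast
  qed
  moreover have "finite ?F"
    using assms(2) by (intro finite_PiE) auto
  ultimately have "card (cube_span p B) \<le> card ?F"
    by (meson card_image_le card_mono finite_imageI order_trans)
  then show ?thesis
    using assms(2) by (simp add: card_PiE numeral_3_eq_3)
qed

text \<open>A nontrivial relation on \<open>insert e B\<close> must involve \<open>e\<close>,
  because \<open>B\<close> alone has none. The coefficient of \<open>e\<close> is then 1 or -1,
  hence its own inverse, and the relation can be solved for \<open>e\<close> with coefficients still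
  in {-1, 0, 1}.\<close>

lemma maximal_dissociated_spans:
  assumes p: "p > 1" and E: "E \<subseteq> carrier (Fp p)"
    and B: "B \<subseteq> E" "dissociated (Fp p) B"
    and max: "\<And>e. e \<in> E \<Longrightarrow> e \<notin> B \<Longrightarrow> \<not> dissociated (Fp p) (insert e B)"
  shows "E \<subseteq> cube_span p B"
proof
  fix e assume e: "e \<in> E"
  have fin: "finite B" and BC: "B \<subseteq> carrier (Fp p)"
    using B(2) p by (auto simp: dissociated_Fp_iff)
  show "e \<in> cube_span p B"
  proof (cases "e \<in> B")
    case True
    then show ?thesis
      using subset_cube_span[OF fin BC] by blast
  next
    case False
    obtain \<epsilon> where \<epsilon>: "\<forall>d\<in>insert e B. \<epsilon> d \<in> {-1, 0, 1}" "\<exists>d\<in>insert e B. \<epsilon> d \<noteq> 0"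
      and "int p dvd (\<Sum>d\<in>insert e B. \<epsilon> d * d)"
      using max[OF e False] p fin BC E e by (simp only: dissociated_Fp_iff) blast
    then have dvd: "int p dvd \<epsilon> e * e + (\<Sum>d\<in>B. \<epsilon> d * d)"
      using False fin by simp
    have "\<epsilon> e \<noteq> 0"
    proof
      assume "\<epsilon> e = 0"
      then have "\<exists>d\<in>B. \<epsilon> d \<noteq> 0" "int p dvd (\<Sum>d\<in>B. \<epsilon> d * d)"
        using \<epsilon> dvd by auto
      then show False
        using B(2) \<epsilon>(1) p by (simp only: dissociated_Fp_iff) blast
    qed
    then have sq: "\<epsilon> e * \<epsilon> e = 1"
      using \<epsilon>(1) by auto
    have "[e = (\<Sum>b\<in>B. (- \<epsilon> e * \<epsilon> b) * b)] (mod int p)"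
    proof -
      have "e - (\<Sum>b\<in>B. (- \<epsilon> e * \<epsilon> b) * b) = (\<epsilon> e * \<epsilon> e) * e + \<epsilon> e * (\<Sum>b\<in>B. \<epsilon> b * b)"
        unfolding sq by (simp add: sum_distrib_left sum_negf algebra_simps)
      also have "\<dots> = \<epsilon> e * (\<epsilon> e * e + (\<Sum>d\<in>B. \<epsilon> d * d))"
        by (simp add: algebra_simps)
      finally show ?thesis
        using dvd by (simp add: cong_iff_dvd_diff)
    qed
    moreover have "\<forall>b\<in>B. - \<epsilon> e * \<epsilon> b \<in> {-1, 0, 1}"
      using \<epsilon>(1) by auto
    ultimately show ?thesis
      using E e unfolding cube_span_def
      by (intro CollectI conjI exI[of _ "\<lambda>b. - \<epsilon> e * \<epsilon> b"]) auto
  qed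
qed

section \<open>Greedy removal of blocks of a fixed size\<close>

lemma greedy_partition:
  assumes "finite A" and "k > 0"
  shows "\<exists>(s::nat) D E. A = (\<Union>j\<in>{1..s}. D j) \<union> E \<and> disjoint_family_on D {1..s} \<and>
    (\<forall>j\<in>{1..s}. D j \<inter> E = {} \<and> P (D j) \<and> card (D j) = k) \<and>
    (\<forall>X\<subseteq>E. P X \<longrightarrow> card X \<noteq> k)"
  using assms(1)
proof (induction A rule: finite_psubset_induct)
  case (psubset A)
  show ?case
  proof (cases "\<exists>X\<subseteq>A. P X \<and> card X = k")
    case False
    then show ?thesis
      by (intro exI[of _ 0] exI[of _ "\<lambda>_. {}"] exI[of _ A]) (auto simp: disjoint_family_on_def)
  next
    case True
    then obtain X where X: "X \<subseteq> A" "P X" "card X = k"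
      by blast
    \<comment> \<open>Since \<open>k > 0\<close>, the removed set is nonempty, so the induction
      really descends. The block \<open>X\<close> later receives the new index
      \<open>Suc s\<close>.\<close>
    then have "A - X \<subset> A"
      using assms(2) by (metis Diff_disjoint Diff_subset card.empty inf.absorb_iff2 inf_commute less_irrefl psubsetI)
    from psubset.IH[OF this] obtain s :: nat and D E where
      IH: "A - X = (\<Union>j\<in>{1..s}. D j) \<union> E" "disjoint_family_on D {1..s}"
        "\<And>j. j \<in> {1..s} \<Longrightarrow> D j \<inter> E = {} \<and> P (D j) \<and> card (D j) = k"
        "\<forall>X\<subseteq>E. P X \<longrightarrow> card X \<noteq> k"
      by auto
    let ?D = "D(Suc s := X)"
    have un: "(\<Union>j\<in>{1..Suc s}. ?D j) = X \<union> (\<Union>j\<in>{1..s}. D j)"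
      by (auto simp: atLeastAtMostSuc_conv)
    have sub: "D j \<inter> X = {}" if "j \<in> {1..s}" for j
      using IH(1) that by blast
    have "A = (\<Union>j\<in>{1..Suc s}. ?D j) \<union> E" (is ?cover)
      unfolding un using IH(1) X(1) by blast
    moreover have "disjoint_family_on ?D {1..Suc s}" (is ?disj)
      unfolding disjoint_family_on_def
    proof (intro ballI impI)
      fix i j assume "i \<in> {1..Suc s}" "j \<in> {1..Suc s}" "i \<noteq> j"
      then consider "i = Suc s" "j \<in> {1..s}" | "j = Suc s" "i \<in> {1..s}"
        | "i \<in> {1..s}" "j \<in> {1..s}" "i \<noteq> j"
        by (auto simp: le_Suc_eq)
      then show "?D i \<inter> ?D j = {}"
        by cases (use sub IH(2) in \<open>auto simp: disjoint_family_on_def\<close>)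
    qed
    moreover have "\<forall>j\<in>{1..Suc s}. ?D j \<inter> E = {} \<and> P (?D j) \<and> card (?D j) = k" (is ?blocks)
    proof
      fix j assume j: "j \<in> {1..Suc s}"
      show "?D j \<inter> E = {} \<and> P (?D j) \<and> card (?D j) = k"
      proof (cases "j = Suc s")
        case True
        have "X \<inter> E = {}"
          using IH(1) by blast
        then show ?thesis
          using True X by simp
      next
        case False
        then have "j \<in> {1..s}"
          using j by simp
        then show ?thesis
          using IH(3) False by simp
      qed
    qed
    ultimately have "?cover \<and> ?disj \<and> ?blocks \<and> (\<forall>X\<subseteq>E. P X \<longrightarrow> card X \<noteq> k)"
      using IH(4) by (intro conjI)
    then show ?thesis
      by - (rule exI[of _ "Suc s"], rule exI[of _ ?D], rule exI[of _ E])
  qed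
qed

section \<open>Simultaneous small dilation by Dirichlet's pigeonhole argument\<close>

lemma dirichlet_dilate:
  fixes S :: "int set"
  assumes "finite S" and Q: "Q > 0" and "Q ^ card S < p"
  shows "\<exists>l\<in>{1..int p - 1}. \<forall>x\<in>S. \<exists>y. [l * x = y] (mod int p) \<and> \<bar>y\<bar> * int Q < int p"
proof -
  have p: "int p > 0"
    using assms(3) by linarith
  \<comment> \<open>Cut [0, p) into \<open>Q\<close> intervals of length p/Q and record, for each
    \<open>x\<close> in \<open>S\<close>, which of them contains the residue of
    \<open>l * x\<close>. There are \<open>p\<close> multipliers but only \<open>Q ^ card S\<close>
    cells, so two multipliers \<open>u < v\<close> share a cell, and \<open>v - u\<close> is the
    dilation factor.\<close>
  define cell where "cell l = (\<lambda>x\<in>S. (int Q * ((l * x) mod int p)) div int p)" for l :: int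
  have "cell ` {0..int p - 1} \<subseteq> PiE S (\<lambda>_. {0..int Q - 1})"
  proof (intro image_subsetI)
    fix l
    have "(int Q * z) div int p \<in> {0..int Q - 1}" if "0 \<le> z" "z < int p" for z
    proof -
      have "int Q * z < int Q * int p"
        using that Q by simp
      moreover have "(int Q * z) div int p * int p \<le> int Q * z"
        using p div_mult_mod_eq[of "int Q * z" "int p"] pos_mod_sign[of "int p" "int Q * z"]
        by linarith
      ultimately have "(int Q * z) div int p * int p < int Q * int p"
        by linarith
      then have "(int Q * z) div int p < int Q"
        using p by (simp add: mult_less_cancel_right)
      then show ?thesis
        using that p by (simp add: pos_imp_zdiv_nonneg_iff)
    qed
    then show "cell l \<in> PiE S (\<lambda>_. {0..int Q - 1})"
      unfolding cell_def by (intro restrict_PiE_iff[THEN iffD2]) (use p in auto)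
  qed
  moreover have "finite (PiE S (\<lambda>_. {0..int Q - 1}))"
    using assms(1) by (intro finite_PiE) auto
  ultimately have "card (cell ` {0..int p - 1}) \<le> card (PiE S (\<lambda>_. {0..int Q - 1}))"
    by (intro card_mono)
  also have "\<dots> = Q ^ card S"
    using assms(1) by (simp add: card_PiE)
  also have "\<dots> < card {0..int p - 1}"
    using assms(3) by simp
  finally have "\<not> inj_on cell {0..int p - 1}"
    using pigeonhole by blast
  then obtain u v where uv: "u \<in> {0..int p - 1}" "v \<in> {0..int p - 1}" "cell u = cell v" "u < v"
    unfolding inj_on_def by (metis linorder_neqE)
  show ?thesis
  proof (intro bexI[of _ "v - u"] ballI)
    show "v - u \<in> {1..int p - 1}"
      using uv by auto
    fix x assume x: "x \<in> S"
    define a b where "a = (u * x) mod int p" and "b = (v * x) mod int p"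
    have eq: "(int Q * a) div int p = (int Q * b) div int p"
      using fun_cong[OF uv(3), of x] x by (simp add: cell_def a_def b_def)
    \<comment> \<open>The quotients by \<open>p\<close> agree, so only the difference of two
      remainders in [0, p) survives.\<close>
    have "int Q * b - int Q * a = (int Q * b) mod int p - (int Q * a) mod int p"
      unfolding minus_div_mult_eq_mod[symmetric] eq by simp
    then have "\<bar>int Q * b - int Q * a\<bar> < int p"
      using pos_mod_bound[OF p, of "int Q * b"] pos_mod_sign[OF p, of "int Q * b"]
        pos_mod_bound[OF p, of "int Q * a"] pos_mod_sign[OF p, of "int Q * a"]
      by linarith
    moreover have "\<bar>int Q * b - int Q * a\<bar> = \<bar>b - a\<bar> * int Q"
      by (simp add: abs_mult flip: right_diff_distrib)
    moreover have "[(v - u) * x = b - a] (mod int p)"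
      by (simp add: cong_def mod_diff_eq left_diff_distrib a_def b_def)
    ultimately show "\<exists>y. [(v - u) * x = y] (mod int p) \<and> \<bar>y\<bar> * int Q < int p"
      by auto
  qed
qed

lemma balanced_rep_eqI:
  assumes "[z = y] (mod int p)" and "2 * \<bar>y\<bar> < int p"
  shows "balanced_rep p (z mod int p) = y"
proof -
  have z: "z mod int p = y mod int p"
    using assms(1) by (simp add: cong_def)
  show ?thesis
  proof (cases "y \<ge> 0")
    case True
    then have "y mod int p = y"
      using assms(2) by simp
    then show ?thesis
      using z True assms(2) by (simp add: balanced_rep_def)
  next
    case False
    \<comment> \<open>For negative \<open>y\<close> the residue is \<open>y + int p\<close>. It lies
      strictly above p/2 because |y| < p/2, so \<open>balanced_rep\<close> subtracts
      \<open>int p\<close> again; equality would select the positive representative.\<close>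
    then have "y mod int p = (y + int p) mod int p"
      by simp
    also have "\<dots> = y + int p"
      using False assms(2) by (intro mod_pos_pos_trivial) auto
    finally show ?thesis
      using z False assms(2) by (simp add: balanced_rep_def)
  qed
qed

text \<open>The two factors \<open>N\<close> in \<open>q = 90 * N^2\<close> have separate tasks: one
  pays for adding up to |B| < N small terms, the other gives the factor \<open>card E + 1\<close> in
  the final bound.\<close>

lemma small_dilate:
  assumes fin: "finite E" "finite B" and BE: "card B \<le> card E" and span: "E \<subseteq> cube_span p B"
    and Q: "(90 * (card E + 1)^2) ^ (card B + 1) < p"
  shows "\<exists>l\<in>{1..int p - 1}. \<forall>x\<in>insert \<delta> E.
    \<bar>balanced_rep p ((l * x) mod int p)\<bar> * (90 * (int (card E) + 1)) < int p"
proof -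
  define N where "N = card E + 1"
  define q where "q = 90 * N^2"
  have N: "N \<ge> 1" and q: "q > 0"
    by (auto simp: N_def q_def)
  \<comment> \<open>Only an inequality, since \<open>\<delta>\<close> may already lie in
    \<open>B\<close>.\<close>
  have "card (insert \<delta> B) \<le> card B + 1"
    using fin by (simp add: card_insert_if)
  then have "q ^ card (insert \<delta> B) \<le> q ^ (card B + 1)"
    using q by (intro power_increasing) auto
  then have "q ^ card (insert \<delta> B) < p"
    using Q unfolding q_def N_def by linarith
  have "finite (insert \<delta> B)"
    using fin by simp
  from dirichlet_dilate[OF this q \<open>q ^ card (insert \<delta> B) < p\<close>] obtain l where l: "l \<in> {1..int p - 1}"
    and "\<forall>x\<in>insert \<delta> B. \<exists>y. [l * x = y] (mod int p) \<and> \<bar>y\<bar> * int q < int p"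
    by blast
  then obtain f where f: "\<And>x. x \<in> insert \<delta> B \<Longrightarrow> [l * x = f x] (mod int p)"
    "\<And>x. x \<in> insert \<delta> B \<Longrightarrow> \<bar>f x\<bar> * int q < int p"
    by metis
  have p: "int p > 0"
    using l by auto
  have "\<exists>y. [l * x = y] (mod int p) \<and> \<bar>y\<bar> * int q < int N * int p"
    if x: "x \<in> insert \<delta> E" for x
  proof (cases "x = \<delta>")
    case True
    have "int p \<le> int N * int p"
      using N by (simp add: mult_le_cancel_right1)
    then show ?thesis
      using f[of \<delta>] True by (intro exI[of _ "f \<delta>"]) auto
  next
    case False
    then have "x \<in> cube_span p B"
      using x span by auto
    then obtain \<epsilon> where \<epsilon>: "\<forall>b\<in>B. \<epsilon> b \<in> {-1, 0, 1}" "[x = (\<Sum>b\<in>B. \<epsilon> b * b)] (mod int p)"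
      unfolding cube_span_def by blast
    have "[l * x = l * (\<Sum>b\<in>B. \<epsilon> b * b)] (mod int p)"
      using \<epsilon>(2) by (rule cong_scalar_left)
    also have "l * (\<Sum>b\<in>B. \<epsilon> b * b) = (\<Sum>b\<in>B. \<epsilon> b * (l * b))"
      by (simp add: sum_distrib_left mult.left_commute)
    also have "[\<dots> = (\<Sum>b\<in>B. \<epsilon> b * f b)] (mod int p)"
      by (intro cong_sum cong_scalar_left f(1)) auto
    finally have "[l * x = (\<Sum>b\<in>B. \<epsilon> b * f b)] (mod int p)" .
    moreover have "\<bar>\<Sum>b\<in>B. \<epsilon> b * f b\<bar> * int q < int N * int p"
    proof -
      have "\<bar>\<Sum>b\<in>B. \<epsilon> b * f b\<bar> * int q \<le> (\<Sum>b\<in>B. \<bar>\<epsilon> b * f b\<bar>) * int q"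
        by (intro mult_right_mono sum_abs) auto
      also have "\<dots> = (\<Sum>b\<in>B. \<bar>\<epsilon> b * f b\<bar> * int q)"
        by (rule sum_distrib_right)
      also have "\<dots> \<le> (\<Sum>b\<in>B. int p)"
      proof (intro sum_mono)
        fix b assume b: "b \<in> B"
        have "\<epsilon> b = -1 \<or> \<epsilon> b = 0 \<or> \<epsilon> b = 1"
          using \<epsilon>(1) b by auto
        then have "\<bar>\<epsilon> b * f b\<bar> * int q \<le> \<bar>f b\<bar> * int q"
          by auto
        then show "\<bar>\<epsilon> b * f b\<bar> * int q \<le> int p"
          using f(2)[of b] b by auto
      qed
      also have "\<dots> = int (card B) * int p"
        by simp
      \<comment> \<open>Strictness comes from |B| \<le> |E| < N, which also covers an empty
        \<open>B\<close>.\<close>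
      also have "\<dots> < int N * int p"
        using BE p by (intro mult_strict_right_mono) (auto simp: N_def)
      finally show ?thesis .
    qed
    ultimately show ?thesis
      by blast
  qed
  moreover have "\<bar>balanced_rep p ((l * x) mod int p)\<bar> * (90 * int N) < int p"
    if y: "[l * x = y] (mod int p)" "\<bar>y\<bar> * int q < int N * int p" for x y
  proof -
    have "int N * (\<bar>y\<bar> * (90 * int N)) < int N * int p"
      using y(2) by (simp add: q_def power2_eq_square ac_simps)
    then have small: "\<bar>y\<bar> * (90 * int N) < int p"
      using N by simp
    \<comment> \<open>The bound p/(90 N) is below p/2, so \<open>y\<close> is itself the balanced
      representative.\<close>
    have "\<bar>y\<bar> * 2 \<le> \<bar>y\<bar> * (90 * int N)"
      using N by (intro mult_left_mono) auto
    then have "2 * \<bar>y\<bar> < int p"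
      using small by linarith
    then show ?thesis
      using balanced_rep_eqI[OF y(1)] small by simp
  qed
  ultimately have "\<forall>x\<in>insert \<delta> E. \<bar>balanced_rep p ((l * x) mod int p)\<bar> * (90 * int N) < int p"
    by blast
  then show ?thesis
    using l by (intro bexI[of _ l]) (auto simp: N_def algebra_simps)
qed

text \<open>Primality enters here: every \<open>l\<close> in \<open>{1..int p - 1}\<close> is a
  unit. As \<open>\<delta>\<close> is an arbitrary integer, any value of the sum over the blocks can
  be inserted later.\<close>

lemma exists_small_unit:
  assumes p: "prime p" and "finite E" "finite B" "card B \<le> card E" "E \<subseteq> cube_span p B"
    and "(90 * (card E + 1)^2) ^ (card B + 1) < p"
  shows "\<exists>l\<in>Units (Fp p). real_of_int ` balanced_rep p ` dilate p l (E \<union> {\<delta>})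
    \<subseteq> {- (real p / (90 * (real (card E) + 1))) <..< real p / (90 * (real (card E) + 1))}"
proof -
  interpret residues_prime p "Fp p"
    using p by unfold_locales auto
  obtain l where l: "l \<in> {1..int p - 1}"
    and small: "\<forall>x\<in>insert \<delta> E.
      \<bar>balanced_rep p ((l * x) mod int p)\<bar> * (90 * (int (card E) + 1)) < int p"
    using small_dilate[OF assms(2-6)] by blast
  have "real_of_int (balanced_rep p (l \<otimes>\<^bsub>Fp p\<^esub> x))
      \<in> {- (real p / (90 * (real (card E) + 1))) <..< real p / (90 * (real (card E) + 1))}"
    if x: "x \<in> E \<union> {\<delta>}" for x
  proof -
    let ?y = "balanced_rep p ((l * x) mod int p)"
    have "real_of_int (\<bar>?y\<bar> * (90 * (int (card E) + 1))) < real_of_int (int p)"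
      using small x by (simp only: of_int_less_iff) auto
    then have "\<bar>real_of_int ?y\<bar> * (90 * (real (card E) + 1)) < real p"
      by simp
    then have "\<bar>real_of_int ?y\<bar> < real p / (90 * (real (card E) + 1))"
      by (simp add: pos_less_divide_eq)
    then show ?thesis
      unfolding res_mult_eq greaterThanLessThan_iff by linarith
  qed
  moreover have "l \<in> Units (Fp p)"
    using l by (simp add: res_prime_units_eq)
  ultimately show ?thesis
    unfolding dilate_def by (intro bexI[of _ l]) auto
qed

section \<open>Numerical conditions for the pigeonhole argument\<close>

lemma nat_power_less_if_ln:
  fixes b n p :: nat
  assumes "b > 0" and "p > 0" and "real n * ln (real b) < ln (real p)"
  shows "b ^ n < p"
proof -
  have "ln (real b ^ n) < ln (real p)"
    using assms by (simp add: ln_realpow)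
  then have "real b ^ n < real p"
    using assms by simp
  then show ?thesis
    by (metis of_nat_less_iff of_nat_power)
qed

text \<open>Here \<open>m\<close> stands for |A|. As N \<le> m + 1 \<le> 2m and 2 \<le> m, the base
  is at most 360 m^2 \<le> 2^9 m^2 \<le> m^11, and 11 * 3/40 < 1. The factor 3/40 is three times the
  constant 1/40 in \<open>R\<close>.\<close>

lemma pigeonhole_bound_small_set:
  assumes "m \<ge> 2" and "N \<le> m + 1" and "p > 1" and "real n \<le> 3 / 40 * (ln (real p) / ln (real m))"
  shows "(90 * N^2) ^ n < p"
proof -
  have "N^2 \<le> (2 * m)^2"
    using assms by (intro power_mono) auto
  then have "90 * N^2 \<le> 2^9 * m^2"
    by (simp add: power_mult_distrib)
  also have "\<dots> \<le> m^9 * m^2"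
    using assms by (intro mult_right_mono power_mono) auto
  finally have "90 * N^2 \<le> m^11"
    by (simp flip: power_add)
  then have "(90 * N^2) ^ n \<le> (m^11) ^ n"
    by (intro power_mono) auto
  also have "\<dots> < p"
  proof (rule nat_power_less_if_ln)
    have lm: "ln (real m) > 0" and lp: "ln (real p) > 0"
      using assms by auto
    have "real n * ln (real m) \<le> 3 / 40 * ln (real p)"
      using assms(4) lm by (simp add: field_simps)
    then have "real n * (11 * ln (real m)) < ln (real p)"
      using lp by simp
    then show "real n * ln (real (m^11)) < ln (real p)"
      using assms by (simp add: ln_realpow)
  qed (use assms in auto)
  finally show ?thesis .
qed

text \<open>The base is at most 90^n * 9^n = 810^n \<le> 2^(10n), so the power is at most 2^(10
  n^2). The hypothesis gives 10 n^2 \<le> (90/1600) ln p < ln p, and ln 2 \<le> 1.\<close>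

lemma pigeonhole_bound_large_set:
  assumes "N \<le> 3 ^ n" and "p > 1" and "n \<ge> 1" and "real n \<le> 3 / 40 * sqrt (ln (real p))"
  shows "(90 * N^2) ^ n < p"
proof -
  have "90 * N^2 \<le> 90 ^ n * (3 ^ n)^2"
    using assms by (intro mult_mono power_mono self_le_power) auto
  also have "\<dots> = 810 ^ n"
    by (simp add: power2_eq_square flip: power_mult_distrib)
  also have "\<dots> \<le> (2 ^ 10) ^ n"
    by (intro power_mono) auto
  finally have "(90 * N^2) ^ n \<le> ((2 ^ 10) ^ n) ^ n"
    by (intro power_mono) auto
  also have "\<dots> = 2 ^ (10 * n^2)"
    by (simp only: power2_eq_square mult.assoc power_mult)
  also have "\<dots> < p"
  proof (rule nat_power_less_if_ln)
    have lp: "ln (real p) > 0"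
      using assms by auto
    have "(real n)^2 \<le> (3 / 40 * sqrt (ln (real p)))^2"
      using assms by (intro power_mono) auto
    also have "\<dots> = 9 / 1600 * ln (real p)"
      using lp by (simp add: power_mult_distrib power_divide)
    finally have "10 * (real n)^2 < ln (real p)"
      using lp by linarith
    moreover have "10 * (real n)^2 * ln 2 \<le> 10 * (real n)^2 * 1"
      using ln_le_minus_one[of "2 :: real"] by (intro mult_left_mono) auto
    ultimately show "real (10 * n^2) * ln (real 2) < ln (real p)"
      by simp
  qed (use assms in auto)
  finally show ?thesis .
qed

lemma pigeonhole_bound:
  assumes p: "p > 1" and A: "finite A" "card A \<ge> 2" and E: "E \<subseteq> A" "E \<subseteq> cube_span p B"
    and B: "finite B"
    and R: "real (card B + 1) \<le>
      3 / 40 * max (sqrt (ln (real p))) (ln (real p) / ln (real (card A)))"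
  shows "(90 * (card E + 1)^2) ^ (card B + 1) < p"
proof (cases "sqrt (ln (real p)) \<le> ln (real p) / ln (real (card A))")
  case True
  have "card E \<le> card A"
    using A(1) E(1) by (rule card_mono)
  then show ?thesis
    using True R p A by (intro pigeonhole_bound_small_set[of "card A"]) auto
next
  case False
  have "finite (cube_span p B)"
    by (rule finite_subset[of _ "carrier (Fp p)"])
      (auto simp: cube_span_def residue_ring_def)
  then have "card E \<le> card (cube_span p B)"
    using E(2) by (rule card_mono)
  also have "\<dots> \<le> 3 ^ card B"
    using p B by (rule card_cube_span_le)
  \<comment> \<open>With \<open>n = card B + 1\<close> one power of 3 is to spare, and it absorbs
    the added 1.\<close>
  finally have "card E + 1 \<le> 3 ^ card B + 3 ^ card B"
    by (intro add_mono) auto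
  also have "\<dots> \<le> 3 ^ (card B + 1)"
    by simp
  finally show ?thesis
    using False R p by (intro pigeonhole_bound_large_set) auto
qed

section \<open>The partition for |A| at least 2\<close>

lemma partition_large_set:
  fixes A :: "int set"
  defines "R \<equiv> \<lambda>p A. 1 / 40 * max (sqrt (ln (real p))) (ln (real p) / ln (real (card A)))"
  assumes p: "prime p" and A: "A \<subseteq> carrier (Fp p)" "card A \<ge> 2" and R4: "R p A \<ge> 4"
  shows "\<exists>(s::nat) D E. A = (\<Union>j\<in>{1..s}. D j) \<union> E \<and> disjoint_family_on D {1..s} \<and>
    (\<forall>j\<in>{1..s}. D j \<inter> E = {} \<and> dissociated (Fp p) (D j) \<and>
       R p A / 4 \<le> real (card (D j)) \<and> real (card (D j)) \<le> 2 * R p A) \<and>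
    (s > 0 \<longrightarrow> R p A / 2 \<le> real (card E)) \<and>
    (\<exists>B. finite B \<and> card B \<le> card E \<and> E \<subseteq> cube_span p B \<and> real (card B + 1) \<le> 3 * R p A)"
proof -
  define r where "r = R p A"
  have r: "r \<ge> 4"
    using R4 by (simp add: r_def)
  have p1: "p > 1"
    using p prime_gt_1_nat by blast
  have fin: "finite A"
    using A(2) by (intro card_ge_0_finite) auto
  \<comment> \<open>Rounding up keeps the block size between r and r + 1 \<le> 2r.\<close>
  define k where "k = nat \<lceil>r\<rceil>"
  have k: "r \<le> real k" "real k < r + 1" "k > 0"
    using r unfolding k_def by linarith+
  obtain s :: nat and D E where
    part: "A = (\<Union>j\<in>{1..s}. D j) \<union> E" "disjoint_family_on D {1..s}"
    and D: "\<forall>j\<in>{1..s}. D j \<inter> E = {} \<and> dissociated (Fp p) (D j) \<and> card (D j) = k"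
    and E: "\<forall>X\<subseteq>E. dissociated (Fp p) X \<longrightarrow> card X \<noteq> k"
    using greedy_partition[OF fin k(3), of "dissociated (Fp p)"] by blast
  have EA: "E \<subseteq> A" "E \<subseteq> carrier (Fp p)" "finite E"
    using part(1) A(1) fin by (auto intro: finite_subset)
  show ?thesis
  proof (cases "s > 0 \<and> real (card E) < r / 2")
    case False
    \<comment> \<open>The remainder can stay as it is; \<open>B\<close> is a maximal dissociated
      subset of \<open>E\<close>.\<close>
    define S where "S = {X. X \<subseteq> E \<and> dissociated (Fp p) X}"
    have "finite S"
      unfolding S_def using EA(3) by auto
    moreover have "{} \<in> S"
      unfolding S_def using p1 by (auto simp: dissociated_Fp_iff)
    ultimately obtain B where B: "B \<in> S" and max: "\<And>X. X \<in> S \<Longrightarrow> B \<subseteq> X \<Longrightarrow> X = B"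
      using finite_has_maximal2[of S "{}"] by blast
    have B': "B \<subseteq> E" "dissociated (Fp p) B" "finite B"
      using B EA(3) finite_subset unfolding S_def by auto
    have "E \<subseteq> cube_span p B"
    proof (rule maximal_dissociated_spans[OF p1 EA(2) B'(1,2)])
      fix e assume "e \<in> E" "e \<notin> B"
      then show "\<not> dissociated (Fp p) (insert e B)"
        using max[of "insert e B"] B'(1) unfolding S_def by auto
    qed
    moreover have "real (card B + 1) \<le> 3 * r"
    proof -
      \<comment> \<open>Otherwise a subset of \<open>B\<close> with exactly \<open>k\<close>
        elements would be a dissociated set that the greedy process missed.\<close>
      have "card B < k"
      proof (rule ccontr)
        assume "\<not> card B < k"
        then obtain X where "X \<subseteq> B" "card X = k"
          by (metis leI obtain_subset_with_card_n)
        then show False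
          using E[rule_format, of X] B'(1) dissociated_Fp_mono[OF p1 B'(2), of X] by auto
      qed
      then show ?thesis
        using k r by linarith
    qed
    ultimately have basis: "\<exists>B. finite B \<and> card B \<le> card E \<and> E \<subseteq> cube_span p B \<and>
        real (card B + 1) \<le> 3 * r"
      using B'(1,3) EA(3) by (intro exI[of _ B]) (simp add: card_mono)
    have "\<forall>j\<in>{1..s}. D j \<inter> E = {} \<and> dissociated (Fp p) (D j) \<and>
       r / 4 \<le> real (card (D j)) \<and> real (card (D j)) \<le> 2 * r"
      using D k r by auto
    moreover have "s > 0 \<longrightarrow> r / 2 \<le> real (card E)"
      using False by auto
    ultimately show ?thesis
      unfolding r_def[symmetric] using part basis
      by - (rule exI[of _ s], rule exI[of _ D], rule exI[of _ E], intro conjI)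
  next
    case True
    \<comment> \<open>Moving \<open>h\<close> elements of the last block into \<open>E\<close>
      brings \<open>E\<close> up to size r/2. The block keeps k - h > r/2 - 1 elements, which is at
      least r/4 precisely because r \<ge> 4.\<close>
    define h where "h = nat \<lceil>r / 2\<rceil>"
    have h: "r / 2 \<le> real h" "real h < r / 2 + 1"
      using r unfolding h_def by linarith+
    have s: "s \<in> {1..s}"
      using True by auto
    have Ds: "D s \<inter> E = {}" "dissociated (Fp p) (D s)" "card (D s) = k"
      using D s by auto
    have "h \<le> k"
      using h k r by linarith
    then obtain Y where Y: "Y \<subseteq> D s" "card Y = h" "finite Y"
      using obtain_subset_with_card_n[of h "D s"] Ds(3) by auto
    have YA: "Y \<subseteq> A"
      using Y(1) part(1) s by blast
    define D' where "D' = D(s := D s - Y)"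
    have D's: "D' s = D s - Y" and D'j: "\<And>j. j \<noteq> s \<Longrightarrow> D' j = D j"
      by (auto simp: D'_def)
    have D'sub: "D' j \<subseteq> D j" and Dsub: "D j \<subseteq> D' j \<union> Y" for j
      by (auto simp: D'_def)
    have cover: "A = (\<Union>j\<in>{1..s}. D' j) \<union> (E \<union> Y)"
    proof (rule antisym)
      have "(\<Union>j\<in>{1..s}. D j) \<subseteq> (\<Union>j\<in>{1..s}. D' j) \<union> Y"
        using Dsub by blast
      then show "A \<subseteq> (\<Union>j\<in>{1..s}. D' j) \<union> (E \<union> Y)"
        unfolding part(1) by auto
      have "(\<Union>j\<in>{1..s}. D' j) \<subseteq> (\<Union>j\<in>{1..s}. D j)"
        using D'sub by (intro UN_mono) auto
      also have "\<dots> \<subseteq> A"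
        unfolding part(1) by (rule Un_upper1)
      finally show "(\<Union>j\<in>{1..s}. D' j) \<union> (E \<union> Y) \<subseteq> A"
        using YA EA(1) by simp
    qed
    have disj: "disjoint_family_on D' {1..s}"
      using part(2) D'sub unfolding disjoint_family_on_def by blast
    have blocks: "\<forall>j\<in>{1..s}. D' j \<inter> (E \<union> Y) = {} \<and> dissociated (Fp p) (D' j) \<and>
       r / 4 \<le> real (card (D' j)) \<and> real (card (D' j)) \<le> 2 * r"
    proof
      fix j assume j: "j \<in> {1..s}"
      show "D' j \<inter> (E \<union> Y) = {} \<and> dissociated (Fp p) (D' j) \<and>
        r / 4 \<le> real (card (D' j)) \<and> real (card (D' j)) \<le> 2 * r"
      proof (cases "j = s")
        case True
        have "dissociated (Fp p) (D s - Y)"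
          using dissociated_Fp_mono[OF p1 Ds(2)] by blast
        moreover have "real (card (D s - Y)) = real k - real h"
          using Y Ds(3) \<open>h \<le> k\<close> by (simp add: card_Diff_subset of_nat_diff)
        ultimately show ?thesis
          unfolding True D's using Ds(1) h k r by auto
      next
        case False
        have "D j \<inter> D s = {}"
          using part(2) j s False unfolding disjoint_family_on_def by blast
        then have "D j \<inter> Y = {}"
          using Y(1) by blast
        then show ?thesis
          using D'j[OF False] D j k r by (auto simp: Int_Un_distrib)
      qed
    qed
    have "E \<inter> Y = {}"
      using Ds(1) Y(1) by blast
    then have cardEY: "real (card (E \<union> Y)) = real (card E) + real h"
      using EA(3) Y by (simp add: card_Un_disjoint)
    \<comment> \<open>The enlarged remainder has fewer than r + 1 elements, so it is small enough to
      serve as its own spanning set.\<close>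
    have "E \<union> Y \<subseteq> cube_span p (E \<union> Y)"
      using EA Y(3) YA A(1) by (intro subset_cube_span) auto
    moreover have "real (card (E \<union> Y) + 1) \<le> 3 * r"
      using cardEY True h r by simp
    ultimately have "\<exists>B. finite B \<and> card B \<le> card (E \<union> Y) \<and> E \<union> Y \<subseteq> cube_span p B \<and>
        real (card B + 1) \<le> 3 * r"
      using EA(3) Y(3) by (intro exI[of _ "E \<union> Y"]) auto
    moreover have "s > 0 \<longrightarrow> r / 2 \<le> real (card (E \<union> Y))"
      using cardEY h by simp
    ultimately show ?thesis
      unfolding r_def[symmetric] using cover disj blocks
      by - (rule exI[of _ s], rule exI[of _ D'], rule exI[of _ "E \<union> Y"], intro conjI)
  qed
qed

section \<open>Choice of the constants and assembly of the two cases\<close>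

theorem theorem3p4:
  shows "\<exists>(c1::real) (\<alpha>::real) (\<beta>::real). c1 > 0 \<and> 0 < \<alpha> \<and> \<alpha> \<le> \<beta> \<and>
    (\<exists>p0::nat. \<forall>(p::nat) (A::int set).
       prime p \<and> p \<ge> p0 \<and> A \<subseteq> carrier (Fp p) \<longrightarrow>
       (\<exists>(s::nat) (D :: nat \<Rightarrow> int set) (E::int set).
          A = (\<Union>j\<in>{1..s}. D j) \<union> E \<and>
          disjoint_family_on D {1..s} \<and>
          (\<forall>j\<in>{1..s}. D j \<inter> E = {}) \<and>
          (\<forall>j\<in>{1..s}. dissociated (Fp p) (D j) \<and>
             ereal \<alpha> * R_param c1 p A \<le> ereal (real (card (D j))) \<and>
             ereal (real (card (D j))) \<le> ereal \<beta> * R_param c1 p A) \<and>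
          (s > 0 \<longrightarrow> R_param c1 p A / 2 \<le> ereal (real (card E))) \<and>
          (\<exists>l\<in>Units (Fp p).
             real_of_int ` balanced_rep p `
               dilate p l (E \<union> {\<Oplus>\<^bsub>Fp p\<^esub>j\<in>{1..s}. \<Oplus>\<^bsub>Fp p\<^esub>d\<in>D j. d})
             \<subseteq> {- (real p / (90 * (real (card E) + 1))) <..<
                 real p / (90 * (real (card E) + 1))})))"
proof (rule exI[of _ "1 / 40"], rule exI[of _ "1 / 4"], rule exI[of _ 2], intro conjI;
    (rule exI[of _ "max 129601 (nat \<lceil>exp (25600 :: real)\<rceil>)"], intro allI impI)?)
  \<comment> \<open>The lower factor 1/4 is dictated by the shortened block, the upper factor 2 by
    rounding \<open>r\<close> up.\<close>
  show "(1 / 40 :: real) > 0" "(0 :: real) < 1 / 4" "(1 / 4 :: real) \<le> 2"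
    by auto
  fix p :: nat and A :: "int set"
  assume asm: "prime p \<and> max 129601 (nat \<lceil>exp (25600 :: real)\<rceil>) \<le> p \<and> A \<subseteq> carrier (Fp p)"
  then have p: "prime p" and p_large: "p \<ge> 129601" and A: "A \<subseteq> carrier (Fp p)"
    by auto
  have "exp 25600 \<le> real p"
    using asm by linarith
  then have ln_p: "ln (real p) \<ge> 25600"
    using p_large by (simp add: ln_ge_iff)
  have fin: "finite A"
    using A by (rule finite_subset) (simp add: residue_ring_def)
  let ?good = "\<lambda>(s::nat) (D :: nat \<Rightarrow> int set) (E::int set).
          A = (\<Union>j\<in>{1..s}. D j) \<union> E \<and>
          disjoint_family_on D {1..s} \<and>
          (\<forall>j\<in>{1..s}. D j \<inter> E = {}) \<and>
          (\<forall>j\<in>{1..s}. dissociated (Fp p) (D j) \<and>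
             ereal (1 / 4) * R_param (1 / 40) p A \<le> ereal (real (card (D j))) \<and>
             ereal (real (card (D j))) \<le> ereal 2 * R_param (1 / 40) p A) \<and>
          (s > 0 \<longrightarrow> R_param (1 / 40) p A / 2 \<le> ereal (real (card E))) \<and>
          (\<exists>l\<in>Units (Fp p).
             real_of_int ` balanced_rep p `
               dilate p l (E \<union> {\<Oplus>\<^bsub>Fp p\<^esub>j\<in>{1..s}. \<Oplus>\<^bsub>Fp p\<^esub>d\<in>D j. d})
             \<subseteq> {- (real p / (90 * (real (card E) + 1))) <..<
                 real p / (90 * (real (card E) + 1))})"
  show "\<exists>s D E. ?good s D E"
  proof (cases "card A \<le> 1")
    case True
    \<comment> \<open>Here \<open>R\<close> is infinite, so no finite block is admissible and s = 0
      is forced. Take \<open>E = A\<close>, spanned by itself. The pigeonhole power is 90 or 360^2 =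
      129600, whence the threshold 129601.\<close>
    then have "card A = 0 \<or> card A = 1"
      by linarith
    then have "(90 * (card A + 1)^2) ^ (card A + 1) < p"
      using p_large by (auto simp: power2_eq_square)
    from exists_small_unit[OF p fin fin order_refl subset_cube_span[OF fin A] this]
    have "?good 0 (\<lambda>_. {}) A"
      by (auto simp: disjoint_family_on_def)
    then show ?thesis
      by - (rule exI[of _ 0], rule exI[of _ "\<lambda>_. {}"], rule exI[of _ A])
  next
    case False
    define r where "r = 1 / 40 * max (sqrt (ln (real p))) (ln (real p) / ln (real (card A)))"
    have R: "R_param (1 / 40) p A = ereal r"
      using False by (auto simp: R_param_def r_def max_def)
    \<comment> \<open>The threshold exp 25600 is chosen for this: 25600 = 160^2 and 160/40 = 4, the
      lower bound on \<open>r\<close> that splitting a block requires.\<close>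
    have "sqrt (ln (real p)) \<ge> 160"
      using ln_p by (intro real_le_rsqrt) auto
    then have r4: "r \<ge> 4"
      unfolding r_def by linarith
    have A2: "card A \<ge> 2"
      using False by simp
    obtain s :: nat and D E B where
      part: "A = (\<Union>j\<in>{1..s}. D j) \<union> E" "disjoint_family_on D {1..s}"
      and D: "\<forall>j\<in>{1..s}. D j \<inter> E = {} \<and> dissociated (Fp p) (D j) \<and>
         r / 4 \<le> real (card (D j)) \<and> real (card (D j)) \<le> 2 * r"
      and E: "s > 0 \<longrightarrow> r / 2 \<le> real (card E)"
      and B: "finite B" "card B \<le> card E" "E \<subseteq> cube_span p B" "real (card B + 1) \<le> 3 * r"
      using partition_large_set[OF p A A2] r4 unfolding r_def[symmetric] by blast
    have EA: "E \<subseteq> A"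
      using part(1) by blast
    have "(90 * (card E + 1)^2) ^ (card B + 1) < p"
      using B(4) p_large by (intro pigeonhole_bound[OF _ fin A2 EA B(3,1)]) (auto simp: r_def)
    \<comment> \<open>The free \<open>\<delta>\<close> is instantiated by the double sum over the
      blocks, which never has to be evaluated.\<close>
    from exists_small_unit[OF p finite_subset[OF EA fin] B(1-3) this]
    have "\<exists>l\<in>Units (Fp p). real_of_int ` balanced_rep p `
         dilate p l (E \<union> {\<Oplus>\<^bsub>Fp p\<^esub>j\<in>{1..s}. \<Oplus>\<^bsub>Fp p\<^esub>d\<in>D j. d})
       \<subseteq> {- (real p / (90 * (real (card E) + 1))) <..< real p / (90 * (real (card E) + 1))}" .
    moreover have "\<forall>j\<in>{1..s}. D j \<inter> E = {}"
      using D by blast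
    moreover have "\<forall>j\<in>{1..s}. dissociated (Fp p) (D j) \<and>
        ereal (1 / 4) * R_param (1 / 40) p A \<le> ereal (real (card (D j))) \<and>
        ereal (real (card (D j))) \<le> ereal 2 * R_param (1 / 40) p A"
      using D by (simp add: R)
    moreover have "s > 0 \<longrightarrow> R_param (1 / 40) p A / 2 \<le> ereal (real (card E))"
      using E by (simp add: R)
    ultimately have "?good s D E"
      using part by (intro conjI)
    then show ?thesis
      by - (rule exI[of _ s], rule exI[of _ D], rule exI[of _ E])
  qed
qed

end
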